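(* Let $q$ be a fixed prime power and let $\mathcal{M}$ be the set of monic polynomials in $\mathbb{F}_q[t]$. There are uncountably many completely multiplicative functions $f:\mathcal{M}\to\{-1,+1\}$ for which $\mathcal{D}_f<\infty$, where $$\mathcal{D}_f:=\sup_{\substack{D\in\mathcal{M}\\ N\geq 1}}\Big|\sum_{\substack{G\in\mathcal{M}\\ \deg(G)\leq N}}f(DG)\Big|.$$
   Context: A function $f$ on $\mathcal{M}$ is completely multiplicative if $f(G_1G_2)=f(G_1)f(G_2)$ for all $G_1,G_2\in\mathcal{M}$. The quantity $\mathcal{D}_f$ is called the long sum discrepancy of $f$. *)

theory Defs
  imports
    "HOL-Computational_Algebra.Polynomial"
    "HOL-Library.Countable_Set"
    "HOL-Library.Extended_Real"
    "HOL-Library.FuncSet"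
begin

definition monic_polys :: "'a::field poly set" where
  "monic_polys = {G. lead_coeff G = 1}"

definition completely_multiplicative :: "('a::field poly \<Rightarrow> int) \<Rightarrow> bool" where
  "completely_multiplicative f \<longleftrightarrow>
     (\<forall>G\<^sub>1\<in>monic_polys. \<forall>G\<^sub>2\<in>monic_polys. f (G\<^sub>1 * G\<^sub>2) = f G\<^sub>1 * f G\<^sub>2)"

text \<open>
  The coefficient field is finite, so the inner sum has finitely many terms (a sum over an
  infinite set would be 0).
\<close>

definition long_sum_discrepancy :: "('a::{field,finite} poly \<Rightarrow> int) \<Rightarrow> ereal" where
  "long_sum_discrepancy f =
     (SUP (D, N) \<in> monic_polys \<times> {N::nat. N \<ge> 1}.
        ereal (real_of_int \<bar>\<Sum>G | G \<in> monic_polys \<and> degree G \<le> N. f (D * G)\<bar>))"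

end

theory Submission
  imports
    Defs
    "HOL-Computational_Algebra.Polynomial_Factorial"
    "HOL-Library.Equipollence"
begin

text \<open>
  Extend a quadratic character \<open>\<chi>\<close> modulo \<open>t\<^sup>2\<close> to a completely multiplicative function \<open>f\<close> by
  \<open>f(t) = -1\<close>. Its L-function is \<open>(1 + c z) / (1 + z)\<close> for some integer \<open>c\<close>, so that the partial
  sums have generating function \<open>(1 + c z) / (1 - z\<^sup>2)\<close> and are bounded. Exchanging the values of \<open>f\<close>
  at two irreducible polynomials of the same degree does not change the L-function, and there are
  infinitely many degrees in which \<open>f\<close> takes both values at irreducible polynomials: otherwise
  \<open>f(P(t))\<close> and \<open>f(P(t + 1))\<close> would agree for all irreducible \<open>P\<close> of large degree, which a
  Euclid style argument refutes. Choosing independently in each of these degrees whether to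
  exchange such a pair gives uncountably many functions.
\<close>

section \<open>Quadratic characters modulo the square of the indeterminate\<close>

lemma card_two_to_one:
  assumes "finite A" and "\<And>y. y \<in> h ` A \<Longrightarrow> card {x \<in> A. h x = y} = 2"
  shows "card A = 2 * card (h ` A)"
proof -
  have "card A = (\<Sum>y\<in>h ` A. card {x \<in> A. h x = y})"
    using sum.image_gen[OF assms(1), of "\<lambda>_. 1::nat" h] by simp
  then show ?thesis
    using assms by simp
qed

text \<open>Here \<open>H\<close> acts as a subgroup of index two and \<open>m\<close> as
  multiplication by a nonmember. Counting shows that \<open>m\<close> maps \<open>H\<close> onto the
  whole complement, so injectivity leaves only \<open>H\<close> for the images of
  nonmembers.\<close>

lemma index_two_product:
  assumes "finite A" "H \<subseteq> A" "card A = 2 * card H"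
    and inj: "inj_on m A" and m: "m ` A \<subseteq> A" "m ` H \<subseteq> A - H"
    and y: "y \<in> A - H"
  shows "m y \<in> H"
proof -
  have "card (m ` H) = card (A - H)"
    using assms by (simp add: card_Diff_subset finite_subset card_image inj_on_subset)
  then have "m ` H = A - H"
    using assms by (intro card_subset_eq) auto
  moreover have "m y \<notin> m ` H"
    using inj y \<open>H \<subseteq> A\<close> by (auto dest: inj_onD)
  moreover have "m y \<in> A"
    using m y by auto
  ultimately show ?thesis
    by blast
qed

text \<open>\<open>\<chi> a b\<close> is the value at the residue class of \<open>a + b t\<close> modulo \<open>t\<^sup>2\<close>; only \<open>a \<noteq> 0\<close> matters.\<close>
locale unit_character =
  fixes \<chi> :: "'a::{field,finite} \<Rightarrow> 'a \<Rightarrow> int"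
  assumes sign: "\<chi> a b \<in> {-1, 1}"
    and mult: "a \<noteq> 0 \<Longrightarrow> c \<noteq> 0 \<Longrightarrow> \<chi> (a * c) (a * d + b * c) = \<chi> a b * \<chi> c d"
    and nontrivial: "\<exists>a b. a \<noteq> 0 \<and> \<chi> a b = -1"

text \<open>Squaring is two-to-one on the nonzero elements, so the squares have index two, and the
  quadratic character of the constant term does the job.\<close>

lemma unit_character_odd:
  fixes \<chi> :: "'a::{field,finite} \<Rightarrow> 'a \<Rightarrow> int"
  assumes "(1::'a) \<noteq> -1"
  defines "H \<equiv> (\<lambda>x::'a. x\<^sup>2) ` (-{0})"
  defines "\<chi> \<equiv> \<lambda>a b. if a \<in> H then 1 else -1"
  shows "unit_character \<chi>"
proof -
  have two: "x \<noteq> - x" if "x \<noteq> 0" for x :: 'a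
  proof
    assume "x = - x"
    then have "x + x = 0"
      by (metis add_eq_0_iff)
    then have "x * (1 + 1) = 0"
      by (simp only: distrib_left mult_1_right)
    then have "1 + 1 = (0::'a)"
      using that by (metis mult_eq_0_iff)
    with assms(1) show False
      by (metis add_eq_0_iff)
  qed
  have "card {x \<in> -{0}. x\<^sup>2 = y} = 2" if "y \<in> H" for y :: 'a
  proof -
    from that obtain s where "s \<noteq> 0" "y = s\<^sup>2"
      by (auto simp: H_def)
    then have "{x \<in> -{0}. x\<^sup>2 = y} = {s, -s}"
      by (auto simp: power2_eq_iff)
    with two[OF \<open>s \<noteq> 0\<close>] show ?thesis
      by simp
  qed
  then have card: "card (-{0::'a}) = 2 * card H"
    unfolding H_def by (intro card_two_to_one) auto
  have H0: "0 \<notin> H" "H \<subseteq> -{0}"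
    by (auto simp: H_def)
  have HH: "x * y \<in> H" if "x \<in> H" "y \<in> H" for x y
    using that by (auto simp: H_def power_mult_distrib[symmetric])
  have NH: "x * y \<notin> H" if "x \<notin> H" "y \<in> H" for x y
  proof
    assume "x * y \<in> H"
    then obtain r s where "r \<noteq> 0" "s \<noteq> 0" "x * s\<^sup>2 = r\<^sup>2"
      using \<open>y \<in> H\<close> by (auto simp: H_def)
    then have "x = (r / s)\<^sup>2" "r / s \<noteq> 0"
      by (auto simp: field_simps power2_eq_square)
    with \<open>x \<notin> H\<close> show False
      by (auto simp: H_def)
  qed
  have NN: "x * y \<in> H" if "x \<noteq> 0" "y \<noteq> 0" "x \<notin> H" "y \<notin> H" for x y
    using that H0 card NH
    by (intro index_two_product[where A = "-{0}" and m = "(*) x"]) (auto simp: inj_on_def)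
  have "1 \<in> H"
    by (auto simp: H_def intro!: image_eqI[of _ _ 1])
  then have "card (-{0::'a}) \<noteq> card H"
    using card by (auto simp: card_gt_0_iff)
  then have "H \<noteq> -{0}"
    by metis
  with H0 obtain a where "a \<noteq> 0" "a \<notin> H"
    by blast
  have "\<chi> (a * c) (a * d + b * c) = \<chi> a b * \<chi> c d" if "a \<noteq> 0" "c \<noteq> 0" for a b c d
    using HH[of a c] NH[of a c] NH[of c a] NN[of a c] that unfolding \<chi>_def mult.commute[of c a]
    by (cases "a \<in> H"; cases "c \<in> H") simp_all
  with \<open>a \<noteq> 0\<close> \<open>a \<notin> H\<close> show ?thesis
    by unfold_locales (auto simp: \<chi>_def)
qed

text \<open>In characteristic two every element is a square, so the linear term has to be used. The
  quotient \<open>b / a\<close> is additive under multiplication modulo t^2, and x^2 + x is additive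
  in x with kernel {0, 1}, so its range has index two.\<close>

lemma unit_character_even:
  fixes \<chi> :: "'a::{field,finite} \<Rightarrow> 'a \<Rightarrow> int"
  assumes char2: "(1::'a) = -1"
  defines "H \<equiv> range (\<lambda>x::'a. x\<^sup>2 + x)"
  defines "\<chi> \<equiv> \<lambda>a b. if b / a \<in> H then 1 else -1"
  shows "unit_character \<chi>"
proof -
  have double: "x + x = 0" for x :: 'a
  proof -
    have "x + x = x * (1 + 1)"
      by (simp add: algebra_simps)
    also have "1 + 1 = (0::'a)"
      using char2 by (simp add: eq_neg_iff_add_eq_0)
    finally show ?thesis
      by simp
  qed
  have minus: "- x = x" for x :: 'a
    using double[of x] by (simp add: minus_unique)
  have add: "(x + y)\<^sup>2 + (x + y) = (x\<^sup>2 + x) + (y\<^sup>2 + y)" for x y :: 'a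
    using double[of "x * y"] by (simp add: power2_eq_square algebra_simps)
  have "card {x \<in> UNIV. x\<^sup>2 + x = y} = 2" if "y \<in> H" for y :: 'a
  proof -
    from that obtain s where y: "y = s\<^sup>2 + s"
      by (auto simp: H_def)
    have "x\<^sup>2 + x = s\<^sup>2 + s \<longleftrightarrow> x = s \<or> x = s + 1" for x
    proof -
      have "x\<^sup>2 + x = s\<^sup>2 + s \<longleftrightarrow> (x\<^sup>2 + x) + (s\<^sup>2 + s) = 0"
        by (metis eq_neg_iff_add_eq_0 minus)
      also have "(x\<^sup>2 + x) + (s\<^sup>2 + s) = (x + s) * (x + s + 1)"
        unfolding add[symmetric] by (simp only: power2_eq_square distrib_left mult_1_right)
      also have "\<dots> = 0 \<longleftrightarrow> x + s = 0 \<or> x + s + 1 = 0"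
        by simp
      also have "\<dots> \<longleftrightarrow> x = s \<or> x = s + 1"
        by (metis add.assoc eq_neg_iff_add_eq_0 minus)
      finally show ?thesis .
    qed
    then have "{x \<in> UNIV. x\<^sup>2 + x = y} = {s, s + 1}"
      by (auto simp: y)
    then show ?thesis
      by simp
  qed
  then have card: "card (UNIV::'a set) = 2 * card H"
    unfolding H_def by (intro card_two_to_one) auto
  have HH: "x + y \<in> H" if "x \<in> H" "y \<in> H" for x y
    using that by (auto simp: H_def add[symmetric])
  have NH: "x + y \<notin> H" if "x \<notin> H" "y \<in> H" for x y
  proof
    assume "x + y \<in> H"
    then have "(x + y) + y \<in> H"
      using HH \<open>y \<in> H\<close> by blast
    then have "x \<in> H"
      by (simp add: add.assoc double)
    with \<open>x \<notin> H\<close> show False ..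
  qed
  have NN: "x + y \<in> H" if "x \<notin> H" "y \<notin> H" for x y
    using that card NH
    by (intro index_two_product[where A = UNIV and m = "(+) x"]) (auto simp: inj_on_def)
  have "card (UNIV::'a set) \<noteq> card H"
    using card by (auto simp: card_gt_0_iff)
  then obtain b where "b \<notin> H"
    by (metis UNIV_eq_I)
  then have b: "\<exists>b. (b / 1) \<notin> H"
    by auto
  have frac: "(a * d + b * c) / (a * c) = b / a + d / c" if "a \<noteq> 0" "c \<noteq> 0" for a b c d :: 'a
    using that by (simp add: field_simps)
  show ?thesis
  proof
    show "\<exists>a b. a \<noteq> 0 \<and> \<chi> a b = -1"
      using b unfolding \<chi>_def by (metis zero_neq_one)
    show "\<chi> (a * c) (a * d + b * c) = \<chi> a b * \<chi> c d" if "a \<noteq> 0" "c \<noteq> 0" for a b c d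
      using HH[of "b / a" "d / c"] NH[of "b / a" "d / c"] NH[of "d / c" "b / a"] NN[of "b / a" "d / c"]
      unfolding \<chi>_def frac[OF that] add.commute[of "d / c"]
      by (cases "b / a \<in> H"; cases "d / c \<in> H") simp_all
  qed (auto simp: \<chi>_def)
qed

lemma unit_character_exists: "\<exists>\<chi> :: 'a::{field,finite} \<Rightarrow> 'a \<Rightarrow> int. unit_character \<chi>"
  using unit_character_odd unit_character_even by blast

section \<open>The base function and its partial sums\<close>

lemma finite_degree_le: "finite {p :: 'a::{zero,finite} poly. degree p \<le> n}"
proof (rule finite_subset)
  show "{p :: 'a poly. degree p \<le> n} \<subseteq> Poly ` {xs. set xs \<subseteq> UNIV \<and> length xs \<le> Suc n}"
  proof
    fix p :: "'a poly"
    assume "p \<in> {p. degree p \<le> n}"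
    then have "p = Poly (coeffs p)" "length (coeffs p) \<le> Suc n"
      by (cases "p = 0"; simp add: length_coeffs_degree)+
    then show "p \<in> Poly ` {xs. set xs \<subseteq> UNIV \<and> length xs \<le> Suc n}"
      by blast
  qed
qed (intro finite_imageI finite_lists_length_le finite)

lemma monic_mult: "P \<in> monic_polys \<Longrightarrow> Q \<in> monic_polys \<Longrightarrow> P * Q \<in> monic_polys"
  by (simp add: monic_polys_def lead_coeff_mult)

lemma monic_power: "P \<in> monic_polys \<Longrightarrow> P ^ n \<in> monic_polys"
  by (simp add: monic_polys_def lead_coeff_power)

lemma monic_one: "1 \<in> monic_polys"
  by (simp add: monic_polys_def)

lemma monic_nonzero: "P \<in> monic_polys \<Longrightarrow> P \<noteq> 0"
  by (auto simp: monic_polys_def)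

lemma monom_mult_decomp:
  fixes p :: "'a::field poly"
  assumes "p \<noteq> 0"
  obtains k H where "p = monom 1 k * H" "coeff H 0 \<noteq> 0"
proof -
  obtain H where "p = [:-0, 1:] ^ order 0 p * H" "\<not> [:-0, 1:] dvd H"
    using order_decomp[OF assms] by blast
  then show ?thesis
    using that[of "order 0 p" H] by (auto simp: monom_altdef dvd_iff_poly_eq_0 poly_0_coeff_0)
qed

context unit_character
begin

text \<open>If G = t^k H with H(0) nonzero, then k is \<open>order 0 G\<close> and the two
  coefficients read off here are the lowest two of H. The power of -1 encodes the value -1 at
  t.\<close>

definition ext :: "'a poly \<Rightarrow> int" where
  "ext G = (-1) ^ order 0 G * \<chi> (coeff G (order 0 G)) (coeff G (Suc (order 0 G)))"

lemma ext_monom_mult: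
  assumes "coeff H 0 \<noteq> 0"
  shows "ext (monom 1 k * H) = (-1) ^ k * \<chi> (coeff H 0) (coeff H 1)"
proof -
  have "H \<noteq> 0"
    using assms by auto
  moreover have "order 0 H = 0"
    using assms by (intro order_0I) (simp add: poly_0_coeff_0)
  ultimately have "order 0 (monom 1 k * H) = k"
    by (subst order_mult) (auto simp: order_0_monom)
  then show ?thesis
    by (simp add: ext_def coeff_monom_mult)
qed

lemma ext_unit: "coeff H 0 \<noteq> 0 \<Longrightarrow> ext H = \<chi> (coeff H 0) (coeff H 1)"
  using ext_monom_mult[of H 0] by simp

lemma ext_pCons_0:
  assumes "G \<noteq> 0"
  shows "ext (pCons 0 G) = - ext G"
proof -
  obtain k H where H: "G = monom 1 k * H" "coeff H 0 \<noteq> 0"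
    using assms by (rule monom_mult_decomp)
  then have "pCons 0 G = monom 1 (Suc k) * H"
    by (simp add: monom_Suc)
  with H show ?thesis
    by (simp add: ext_monom_mult)
qed

lemma ext_mult:
  assumes "G \<noteq> 0" "G' \<noteq> 0"
  shows "ext (G * G') = ext G * ext G'"
proof -
  obtain k H k' H' where H: "G = monom 1 k * H" "coeff H 0 \<noteq> 0"
    and H': "G' = monom 1 k' * H'" "coeff H' 0 \<noteq> 0"
    using monom_mult_decomp assms by metis
  have "G * G' = monom 1 (k + k') * (H * H')"
  proof -
    have "monom 1 (k + k') = monom 1 k * monom (1::'a) k'"
      by (simp add: mult_monom)
    then show ?thesis
      by (simp only: H(1) H'(1) mult_ac)
  qed
  moreover have "coeff (H * H') 1 = coeff H 0 * coeff H' 1 + coeff H 1 * coeff H' 0"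
    by (simp add: coeff_mult)
  ultimately have "ext (G * G') = (-1) ^ (k + k') * \<chi> (coeff H 0 * coeff H' 0)
      (coeff H 0 * coeff H' 1 + coeff H 1 * coeff H' 0)"
    using H H' by (simp only: ext_monom_mult coeff_mult_0 mult_eq_0_iff simp_thms)
  then show ?thesis
    unfolding H(1) H'(1) ext_monom_mult[OF H(2)] ext_monom_mult[OF H'(2)] mult[OF H(2) H'(2)]
    by (simp add: power_add)
qed

lemma completely_multiplicative_ext: "completely_multiplicative ext"
  by (simp add: completely_multiplicative_def ext_mult monic_nonzero)

lemma ext_sign: "ext G \<in> {-1, 1}"
  using sign[of "coeff G (order 0 G)" "coeff G (Suc (order 0 G))"]
  by (cases "even (order 0 G)") (auto simp: ext_def)

lemma chi_one: "\<chi> 1 0 = 1"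
  using mult[of 1 1 0 0] sign[of 1 0] by auto

text \<open>
  Multiplying the two lowest coefficients, as a unit modulo \<open>t\<^sup>2\<close>, by a unit on which the
  character is \<open>-1\<close> permutes the index set and changes every sign.
\<close>
lemma sum_ext_units:
  "(\<Sum>G | G \<in> monic_polys \<and> degree G = Suc (Suc n) \<and> coeff G 0 \<noteq> 0. ext G) = 0"
proof -
  define A where "A = {G :: 'a poly. G \<in> monic_polys \<and> degree G = Suc (Suc n) \<and> coeff G 0 \<noteq> 0}"
  obtain u v where u: "u \<noteq> 0" "\<chi> u v = -1"
    using nontrivial by blast
  \<comment> \<open>With a, b the two lowest coefficients of \<open>G\<close>, the new ones are
    those of (a + b t)(u + v t) modulo t^2. The correction has degree at most 1, so a monic
    polynomial of degree at least 2 stays monic of the same degree.\<close>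
  define T where "T G = G + [:coeff G 0 * u - coeff G 0, coeff G 0 * v + coeff G 1 * u - coeff G 1:]"
    for G :: "'a poly"
  have T0: "coeff (T G) 0 = coeff G 0 * u" and T1: "coeff (T G) 1 = coeff G 0 * v + coeff G 1 * u"
    and T2: "coeff (T G) (Suc (Suc i)) = coeff G (Suc (Suc i))" for G i
    by (simp_all add: T_def)
  have fin: "finite A"
    by (rule finite_subset[OF _ finite_degree_le[of "Suc (Suc n)"]]) (auto simp: A_def)
  have "inj_on T A"
  proof (rule inj_onI)
    fix G G' assume "T G = T G'"
    then have eq: "coeff (T G) i = coeff (T G') i" for i
      by simp
    have "coeff G 0 = coeff G' 0"
      using eq[of 0] u(1) by (simp add: T0)
    moreover from this have "coeff G 1 = coeff G' 1"
      using eq[of 1] u(1) by (simp add: T1 del: One_nat_def)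
    ultimately have "coeff G i = coeff G' i" for i
      using eq[of i] T2 by (cases i; cases "i - 1") auto
    then show "G = G'"
      by (simp add: poly_eq_iff)
  qed
  moreover have "T ` A \<subseteq> A"
  proof
    fix G' assume "G' \<in> T ` A"
    then obtain G where G: "G \<in> A" "G' = T G"
      by blast
    have "degree [:coeff G 0 * u - coeff G 0, coeff G 0 * v + coeff G 1 * u - coeff G 1:] < degree G"
      using G(1) by (simp add: A_def)
    then have "degree (T G) = degree G"
      unfolding T_def by (rule degree_add_eq_left)
    with G u T2 show "G' \<in> A"
      by (auto simp: A_def T0 monic_polys_def)
  qed
  ultimately have "bij_betw T A A"
    using endo_inj_surj[OF fin] by (simp add: bij_betw_def)
  then have "sum ext A = (\<Sum>G\<in>A. ext (T G))"
    by (rule sum.reindex_bij_betw[symmetric])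
  also have "\<dots> = (\<Sum>G\<in>A. - ext G)"
  proof (rule sum.cong)
    fix G assume "G \<in> A"
    then have G0: "coeff G 0 \<noteq> 0"
      by (simp add: A_def)
    then have "ext (T G) = \<chi> (coeff G 0 * u) (coeff G 0 * v + coeff G 1 * u)"
      using u(1) by (subst ext_unit) (simp_all only: T0 T1 mult_eq_0_iff simp_thms)
    then show "ext (T G) = - ext G"
      using mult[OF G0 u(1)] u(2) ext_unit[OF G0] by simp
  qed simp
  finally show ?thesis
    by (simp add: A_def sum_negf)
qed

definition partial_sum :: "nat \<Rightarrow> int" where
  "partial_sum N = (\<Sum>G | G \<in> monic_polys \<and> degree G \<le> N. ext G)"

text \<open>Split by divisibility by t: the multiples of t are the t G with \<open>degree G\<close>
  at most \<open>N\<close>, and the value -1 at t reverses their signs.\<close>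

lemma partial_sum_Suc:
  "partial_sum (Suc N) =
     (\<Sum>G | G \<in> monic_polys \<and> degree G \<le> Suc N \<and> coeff G 0 \<noteq> 0. ext G) - partial_sum N"
proof -
  define A where "A = {G :: 'a poly. G \<in> monic_polys \<and> degree G \<le> Suc N \<and> coeff G 0 \<noteq> 0}"
  define B where "B = {G :: 'a poly. G \<in> monic_polys \<and> degree G \<le> N}"
  have fin: "finite A" "finite B"
    by (rule finite_subset[OF _ finite_degree_le[of "Suc N"]]; auto simp: A_def B_def)+
  have "{G. G \<in> monic_polys \<and> degree G \<le> Suc N} = A \<union> pCons 0 ` B"
  proof (intro equalityI subsetI)
    fix G :: "'a poly" assume G: "G \<in> {G. G \<in> monic_polys \<and> degree G \<le> Suc N}"
    obtain a R where "G = pCons a R"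
      by (rule pCons_cases)
    with G show "G \<in> A \<union> pCons 0 ` B"
      by (cases "a = 0"; cases "R = 0") (auto simp: A_def B_def monic_polys_def)
  qed (auto simp: A_def B_def monic_polys_def)
  moreover have "A \<inter> pCons 0 ` B = {}"
    by (auto simp: A_def)
  ultimately have "partial_sum (Suc N) = sum ext A + sum ext (pCons 0 ` B)"
    using fin by (simp add: partial_sum_def sum.union_disjoint)
  also have "sum ext (pCons 0 ` B) = (\<Sum>G\<in>B. ext (pCons 0 G))"
    by (rule sum.reindex_cong[of "pCons 0"]) (auto simp: inj_on_def)
  also have "\<dots> = (\<Sum>G\<in>B. - ext G)"
    by (intro sum.cong refl ext_pCons_0) (auto simp: B_def monic_nonzero)
  finally show ?thesis
    by (simp add: A_def B_def partial_sum_def sum_negf)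
qed

text \<open>By \<open>sum_ext_units\<close> the sum over the polynomials prime to t no longer
  changes. It therefore cancels when the recursion is applied twice.\<close>

lemma partial_sum_periodic: "partial_sum (Suc (Suc (Suc N))) = partial_sum (Suc N)"
proof -
  define U where "U n = {G :: 'a poly. G \<in> monic_polys \<and> degree G \<le> n \<and> coeff G 0 \<noteq> 0}" for n
  define V where "V = {G :: 'a poly. G \<in> monic_polys \<and> degree G = Suc (Suc (Suc N)) \<and> coeff G 0 \<noteq> 0}"
  have fin: "finite (U n)" for n
    by (rule finite_subset[OF _ finite_degree_le[of n]]) (auto simp: U_def)
  have "U (Suc (Suc (Suc N))) = U (Suc (Suc N)) \<union> V" "U (Suc (Suc N)) \<inter> V = {}"
    by (auto simp: U_def V_def)
  moreover from this have "finite V"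
    using fin by (metis finite_Un)
  ultimately have "sum ext (U (Suc (Suc (Suc N)))) = sum ext (U (Suc (Suc N))) + sum ext V"
    using fin by (simp add: sum.union_disjoint)
  moreover have "sum ext V = 0"
    unfolding V_def by (rule sum_ext_units)
  ultimately show ?thesis
    using partial_sum_Suc[of "Suc (Suc N)"] partial_sum_Suc[of "Suc N"] by (simp add: U_def)
qed

lemma partial_sum_bounded: "\<exists>B. \<forall>N. \<bar>partial_sum N\<bar> \<le> B"
proof -
  define B where "B = \<bar>partial_sum 0\<bar> + \<bar>partial_sum 1\<bar> + \<bar>partial_sum 2\<bar>"
  have "\<bar>partial_sum N\<bar> \<le> B" for N
  proof (induction N rule: less_induct)
    case (less N)
    consider "N = 0" | "N = 1" | "N = 2" | n where "N = Suc (Suc (Suc n))"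
      by (metis One_nat_def Suc_1 old.nat.exhaust)
    then show ?case
    proof cases
      case 4
      with less.IH[of "Suc n"] show ?thesis
        by (simp add: partial_sum_periodic)
    qed (auto simp: B_def)
  qed
  then show ?thesis
    by blast
qed

end

section \<open>Irreducible polynomials distinguished by a translation\<close>

lemma pcompose_shift_inverse:
  fixes p :: "'a::comm_ring_1 poly"
  shows "pcompose (pcompose p [:1, 1:]) [:-1, 1:] = p"
  by (subst pcompose_assoc[symmetric]) (simp add: pcompose_pCons)

lemma monic_shift: "P \<in> monic_polys \<Longrightarrow> pcompose P [:1, 1:] \<in> monic_polys"
  by (simp add: monic_polys_def lead_coeff_comp)

lemma irreducible_shift:
  fixes p :: "'a::field poly"
  assumes "irreducible p"
  shows "irreducible (pcompose p [:1, 1:])"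
proof (rule irreducibleI)
  have deg: "degree p \<noteq> 0"
    using assms by (auto simp: irreducible_def is_unit_iff_degree)
  then show "pcompose p [:1, 1:] \<noteq> 0"
    by (auto simp: pcompose_eq_0_iff)
  then show "\<not> is_unit (pcompose p [:1, 1:])"
    using deg by (simp add: is_unit_iff_degree degree_pcompose)
  fix a b assume ab: "pcompose p [:1, 1:] = a * b"
  then have "p = pcompose a [:-1, 1:] * pcompose b [:-1, 1:]"
    using pcompose_shift_inverse[of p] by (simp add: pcompose_mult)
  then have "is_unit (pcompose a [:-1, 1:]) \<or> is_unit (pcompose b [:-1, 1:])"
    using assms irreducibleD by blast
  moreover have "a \<noteq> 0" "b \<noteq> 0"
    using ab \<open>pcompose p [:1, 1:] \<noteq> 0\<close> by auto
  moreover have "is_unit c" if "is_unit (pcompose c [:-1, 1:])" "c \<noteq> 0" for c :: "'a poly"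
  proof -
    have "pcompose c [:-1, 1:] \<noteq> 0"
      using that(1) by auto
    with that show ?thesis
      by (simp add: is_unit_iff_degree degree_pcompose)
  qed
  ultimately show "is_unit a \<or> is_unit b"
    by blast
qed

text \<open>Induction on the degree: two multiplicative functions that differ at a product differ at
  one of its factors. Degree 0 cannot occur, since the only monic constant is 1.\<close>

lemma exists_irreducible_factor_neq:
  fixes f g :: "'a::field poly \<Rightarrow> int"
  assumes f: "completely_multiplicative f" and g: "completely_multiplicative g"
    and "f 1 = g 1" "G \<in> monic_polys" "f G \<noteq> g G"
  shows "\<exists>P. P \<in> monic_polys \<and> irreducible P \<and> P dvd G \<and> f P \<noteq> g P"
  using assms(4,5)
proof (induction "degree G" arbitrary: G rule: less_induct)
  case less
  show ?case
  proof (cases "irreducible G")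
    case True
    with less.prems show ?thesis
      by (intro exI[of _ G]) simp
  next
    case False
    have "G \<noteq> 0"
      using less.prems(1) by (rule monic_nonzero)
    have "degree G \<noteq> 0"
    proof
      assume "degree G = 0"
      then obtain c where "G = [:c:]"
        by (rule degree_eq_zeroE)
      with less.prems(1) have "G = 1"
        by (simp add: monic_polys_def one_pCons)
      with less.prems(2) \<open>f 1 = g 1\<close> show False
        by simp
    qed
    with False \<open>G \<noteq> 0\<close> obtain A B where AB: "G = A * B" "\<not> is_unit A" "\<not> is_unit B"
      by (auto simp: irreducible_def is_unit_iff_degree)
    \<comment> \<open>Moving the leading coefficient of \<open>A\<close> over to \<open>B\<close>
      makes both factors monic, because their product is.\<close>
    define A' where "A' = smult (inverse (lead_coeff A)) A"
    define B' where "B' = smult (lead_coeff A) B"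
    have nz: "A \<noteq> 0" "B \<noteq> 0"
      using AB(1) \<open>G \<noteq> 0\<close> by auto
    then have pos: "degree A > 0" "degree B > 0"
      using AB by (auto simp: is_unit_iff_degree)
    have G: "G = A' * B'"
      using nz by (simp add: A'_def B'_def AB(1))
    have monic: "A' \<in> monic_polys" "B' \<in> monic_polys"
      using less.prems(1) nz by (auto simp: A'_def B'_def AB(1) monic_polys_def lead_coeff_mult)
    have "degree A' < degree G" "degree B' < degree G"
      using nz pos by (simp_all add: A'_def B'_def AB(1) degree_mult_eq)
    moreover have "f A' \<noteq> g A' \<or> f B' \<noteq> g B'"
      using less.prems(2) f g monic by (auto simp: G completely_multiplicative_def)
    ultimately show ?thesis
      using less.hyps monic G by (metis dvd_mult dvd_mult2)
  qed
qed

context unit_character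
begin

text \<open>
  Here \<open>G\<close> is chosen to be \<open>1\<close> modulo all irreducible polynomials of small degree other than the
  indeterminate \<open>t\<close>, to be \<open>1\<close> modulo \<open>(t - 1)\<^sup>2\<close>, and to have prescribed residue modulo \<open>t\<^sup>2\<close>.
  Translation moves the second condition to \<open>t\<^sup>2\<close>, and so \<open>G\<close> and its translate have different
  values, which forces the same for one of the irreducible factors of \<open>G\<close>.
\<close>
lemma exists_irreducible_shift_neq:
  "\<exists>P. P \<in> monic_polys \<and> irreducible P \<and> D \<le> degree P \<and> ext P \<noteq> ext (pcompose P [:1, 1:])"
proof -
  define I where "I = {P :: 'a poly. P \<in> monic_polys \<and> degree P \<le> D \<and> coeff P 0 \<noteq> 0}"
  have "finite I"
    by (rule finite_subset[OF _ finite_degree_le[of D]]) (auto simp: I_def)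
  define W where "W = (\<Prod>P\<in>I. P) * [:-1, 1:]\<^sup>2"
  have prod: "(\<Prod>P\<in>J. P) \<in> monic_polys \<and> coeff (\<Prod>P\<in>J. P) 0 \<noteq> 0" if "finite J" "J \<subseteq> I" for J
    using that by (induction J) (auto simp: I_def monic_one coeff_mult_0 intro!: monic_mult)
  have linear: "[:-1, 1:] \<in> (monic_polys :: 'a poly set)"
    by (simp add: monic_polys_def)
  have W: "W \<in> monic_polys" "coeff W 0 \<noteq> 0"
    unfolding W_def using prod[OF \<open>finite I\<close>]
    by (auto simp: coeff_mult_0 power2_eq_square[of "[:-1, 1:]"] simp del: mult_pCons_left mult_pCons_right
        intro!: monic_mult linear)
  obtain u v where u: "u \<noteq> 0" "\<chi> u v = -1"
    using nontrivial by blast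
  \<comment> \<open>\<open>h\<close> and \<open>k\<close> solve 1 + H W = u + v t modulo t^2, which
    is possible since W(0) is nonzero. The further coefficient 1 in \<open>H\<close> makes it
    monic.\<close>
  define h where "h = (u - 1) / coeff W 0"
  define k where "k = (v - h * coeff W 1) / coeff W 0"
  define H where "H = [:h, k, 1:]"
  define G where "G = 1 + H * W"
  have "H \<in> monic_polys"
    by (simp add: H_def monic_polys_def)
  then have HW: "H * W \<in> monic_polys"
    using W by (rule_tac monic_mult)
  moreover have "degree (1 :: 'a poly) < degree (H * W)"
    using W by (subst degree_mult_eq) (auto simp: H_def monic_nonzero)
  ultimately have G: "G \<in> monic_polys"
    using lead_coeff_add_le[of 1 "H * W"] unfolding G_def monic_polys_def by simp
  have G0: "coeff G 0 = u" and G1: "coeff G 1 = v"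
    using W(2) by (simp_all add: G_def H_def h_def k_def coeff_mult)
  have "ext G = -1"
    using ext_unit[of G] u by (simp add: G0 G1 del: One_nat_def)
  have "pcompose G [:1, 1:] = 1 + pcompose (H * (\<Prod>P\<in>I. P)) [:1, 1:] * (pcompose [:-1, 1:] [:1, 1:])\<^sup>2"
    by (simp only: G_def W_def pcompose_add pcompose_mult pcompose_1 power2_eq_square mult.assoc)
  also have "pcompose [:-1, 1:] [:1, 1:] = ([:0, 1:] :: 'a poly)"
    by (simp add: pcompose_pCons)
  finally obtain R where "pcompose G [:1, 1:] = 1 + R * [:0, 1:]\<^sup>2"
    by blast
  then have "pcompose G [:1, 1:] = pCons 1 (pCons 0 R)"
    by (simp add: power2_eq_square one_pCons)
  then have "ext (pcompose G [:1, 1:]) = 1"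
    by (simp add: ext_unit chi_one)
  have "completely_multiplicative (\<lambda>P. ext (pcompose P [:1, 1:]))"
    by (auto simp: completely_multiplicative_def pcompose_mult intro!: ext_mult monic_nonzero monic_shift)
  with completely_multiplicative_ext obtain P where P: "P \<in> monic_polys" "irreducible P" "P dvd G"
    and neq: "ext P \<noteq> ext (pcompose P [:1, 1:])"
    using exists_irreducible_factor_neq[of ext "\<lambda>P. ext (pcompose P [:1, 1:])" G] G
      \<open>ext G = -1\<close> \<open>ext (pcompose G [:1, 1:]) = 1\<close> by (auto simp: pcompose_1)
  \<comment> \<open>The set \<open>I\<close> omits the multiples of t, so the case that
    \<open>P\<close> is t must be excluded separately.\<close>
  have "coeff P 0 \<noteq> 0"
    using P(3) u(1) G0 by (auto simp: coeff_mult_0 elim!: dvdE)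
  have "P \<notin> I"
  proof
    assume "P \<in> I"
    then have "P dvd (\<Prod>P\<in>I. P)"
      using \<open>finite I\<close> by (rule_tac dvd_prodI)
    then have "P dvd H * W"
      by (simp add: W_def)
    with P(3) have "P dvd 1"
      by (simp add: G_def dvd_add_left_iff)
    with P(2) show False
      by (simp add: irreducible_def)
  qed
  then have "D \<le> degree P"
    using P(1) \<open>coeff P 0 \<noteq> 0\<close> by (simp add: I_def)
  with P neq show ?thesis
    by blast
qed

end

section \<open>Exchanging two irreducible polynomials\<close>

text \<open>\<open>GREATEST\<close> is meaningful only for bounded exponents. The lemmas that
  compute values exclude the degenerate cases, such as \<open>G = 0\<close>, by their
  hypotheses.\<close>

definition valuation :: "'a::field poly \<Rightarrow> 'a poly \<Rightarrow> nat" where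
  "valuation P G = (GREATEST n. P ^ n dvd G)"

lemma valuation_eqI:
  assumes "P \<noteq> 0" "\<not> P dvd H"
  shows "valuation P (P ^ n * H) = n"
  unfolding valuation_def
proof (rule Greatest_equality)
  fix m assume m: "P ^ m dvd P ^ n * H"
  show "m \<le> n"
  proof (rule ccontr)
    assume "\<not> m \<le> n"
    then have "P ^ Suc n dvd P ^ m"
      by (intro le_imp_power_dvd) simp
    with m have "P ^ n * P dvd P ^ n * H"
      by (metis dvd_trans power_Suc2)
    with assms show False
      by simp
  qed
qed simp

lemma valuation_eq_0: "P \<noteq> 0 \<Longrightarrow> \<not> P dvd G \<Longrightarrow> valuation P G = 0"
  using valuation_eqI[of P G 0] by simp

lemma valuation_decomp:
  fixes P :: "'a::field poly"
  assumes "irreducible P" "G \<noteq> 0"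
  obtains n H where "G = P ^ n * H" "\<not> P dvd H"
proof -
  have "degree P > 0"
    using assms(1) by (auto simp: irreducible_def is_unit_iff_degree)
  have "\<exists>n H. G = P ^ n * H \<and> \<not> P dvd H"
    using assms(2)
  proof (induction "degree G" arbitrary: G rule: less_induct)
    case less
    show ?case
    proof (cases "P dvd G")
      case True
      then obtain G' where G: "G = P * G'"
        by blast
      with less.prems \<open>degree P > 0\<close> have "degree G' < degree G" "G' \<noteq> 0"
        by (auto simp: degree_mult_eq)
      then obtain n H where "G' = P ^ n * H" "\<not> P dvd H"
        using less.hyps by blast
      then have "G = P ^ Suc n * H"
        by (simp add: G)
      with \<open>\<not> P dvd H\<close> show ?thesis
        by blast
    next
      case False
      then show ?thesis
        by (intro exI[of _ 0] exI[of _ G]) simp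
    qed
  qed
  with that show ?thesis
    by blast
qed

lemma valuation_mult:
  assumes "irreducible P" "G \<noteq> 0" "G' \<noteq> 0"
  shows "valuation P (G * G') = valuation P G + valuation P G'"
proof -
  have P: "P \<noteq> 0" "prime_elem P"
    using assms(1) by (auto simp: field_poly_irreducible_imp_prime)
  obtain n H where H: "G = P ^ n * H" "\<not> P dvd H"
    using assms(1,2) by (rule valuation_decomp)
  obtain n' H' where H': "G' = P ^ n' * H'" "\<not> P dvd H'"
    using assms(1,3) by (rule valuation_decomp)
  have "G * G' = P ^ (n + n') * (H * H')"
    by (simp add: H(1) H'(1) power_add mult_ac)
  moreover have "\<not> P dvd H * H'"
    using P(2) H(2) H'(2) by (simp add: prime_elem_dvd_mult_iff)
  ultimately have "valuation P (G * G') = n + n'"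
    using P(1) by (simp add: valuation_eqI)
  moreover have "valuation P G = n" "valuation P G' = n'"
    using H H' P(1) by (simp_all add: valuation_eqI)
  ultimately show ?thesis
    by simp
qed

lemma valuation_degree_less:
  assumes "degree G < degree P" "G \<noteq> 0"
  shows "valuation P G = 0"
proof (rule valuation_eq_0)
  show "\<not> P dvd G"
    using assms dvd_imp_degree_le[of P G] by auto
qed (use assms in auto)

lemma monic_irreducible_dvd_imp_eq:
  fixes P Q :: "'a::field poly"
  assumes "P \<in> monic_polys" "Q \<in> monic_polys" "irreducible P" "irreducible Q" "P dvd Q"
  shows "P = Q"
proof -
  obtain R where R: "Q = P * R"
    using assms(5) by blast
  with assms have "is_unit R"
    using irreducibleD[OF assms(4) R] by (simp add: irreducible_def)
  then obtain c where "R = [:c:]"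
    by (auto elim: is_unit_polyE)
  with R assms(1,2) show ?thesis
    by (cases "c = 0") (auto simp: monic_polys_def)
qed

text \<open>Equality of the degrees is what makes the exchange of \<open>P\<close> and
  \<open>Q\<close> preserve the ranges of summation.\<close>

locale irreducible_pair =
  fixes P Q :: "'a::field poly"
  assumes monic: "P \<in> monic_polys" "Q \<in> monic_polys"
    and irred: "irreducible P" "irreducible Q"
    and neq: "P \<noteq> Q"
    and deg: "degree P = degree Q"
begin

lemma not_dvd: "\<not> P dvd Q" "\<not> Q dvd P"
  using monic_irreducible_dvd_imp_eq monic irred neq by metis+

lemma nonzero: "P \<noteq> 0" "Q \<noteq> 0"
  using monic monic_nonzero by auto

lemma prime: "prime_elem P" "prime_elem Q"
  using irred by (auto intro: field_poly_irreducible_imp_prime)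

lemma valuation_pair:
  assumes "\<not> P dvd H" "\<not> Q dvd H"
  shows "valuation P (P ^ a * Q ^ b * H) = a" "valuation Q (P ^ a * Q ^ b * H) = b"
proof -
  have "\<not> P dvd Q ^ b * H" "\<not> Q dvd P ^ a * H"
    using assms prime not_dvd by (auto simp: prime_elem_dvd_mult_iff dest: prime_elem_dvd_power)
  then show "valuation P (P ^ a * Q ^ b * H) = a" "valuation Q (P ^ a * Q ^ b * H) = b"
    using valuation_eqI[of P "Q ^ b * H" a] valuation_eqI[of Q "P ^ a * H" b] nonzero
    by (auto simp: mult_ac)
qed

lemma pair_decomp:
  assumes "G \<in> monic_polys"
  obtains a b H where "G = P ^ a * Q ^ b * H" "\<not> P dvd H" "\<not> Q dvd H" "H \<in> monic_polys"
proof -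
  have "G \<noteq> 0"
    using assms by (rule monic_nonzero)
  with irred(1) obtain a H1 where H1: "G = P ^ a * H1" "\<not> P dvd H1"
    by (rule valuation_decomp)
  then have "H1 \<noteq> 0"
    by auto
  with irred(2) obtain b H where H: "H1 = Q ^ b * H" "\<not> Q dvd H"
    by (rule valuation_decomp)
  have "H \<in> monic_polys"
    using assms monic by (simp add: H1(1) H(1) monic_polys_def lead_coeff_mult lead_coeff_power)
  moreover have "G = P ^ a * Q ^ b * H" "\<not> P dvd H"
    using H1 by (auto simp: H(1) mult_ac)
  ultimately show ?thesis
    using that H(2) by blast
qed

text \<open>The quotient is the cofactor prime to both \<open>P\<close> and \<open>Q\<close>; for
  nonzero \<open>G\<close> the division is exact.\<close>

definition swap :: "'a poly \<Rightarrow> 'a poly" where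
  "swap G = P ^ valuation Q G * Q ^ valuation P G * (G div (P ^ valuation P G * Q ^ valuation Q G))"

lemma swap_eq:
  assumes "\<not> P dvd H" "\<not> Q dvd H"
  shows "swap (P ^ a * Q ^ b * H) = P ^ b * Q ^ a * H"
proof -
  have "P ^ a * Q ^ b \<noteq> 0"
    using nonzero by auto
  then have "(P ^ a * Q ^ b * H) div (P ^ a * Q ^ b) = H"
    by (rule nonzero_mult_div_cancel_left)
  then show ?thesis
    by (simp add: swap_def valuation_pair[OF assms])
qed

lemma swap_monic:
  assumes "G \<in> monic_polys"
  shows "swap G \<in> monic_polys" "degree (swap G) = degree G" "swap (swap G) = G"
proof -
  obtain a b H where H: "G = P ^ a * Q ^ b * H" "\<not> P dvd H" "\<not> Q dvd H" "H \<in> monic_polys"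
    using assms by (rule pair_decomp)
  show "swap G \<in> monic_polys" "swap (swap G) = G"
    using H monic by (auto simp: swap_eq intro!: monic_mult monic_power)
  show "degree (swap G) = degree G"
    using H nonzero monic_nonzero[OF H(4)] by (simp add: swap_eq degree_mult_eq degree_power_eq deg)
qed

text \<open>
  If \<open>g\<close> takes opposite values at \<open>P\<close> and \<open>Q\<close>, then changing both signs has the same effect as
  composing \<open>g\<close> with the degree preserving involution that exchanges \<open>P\<close> and \<open>Q\<close>.
\<close>
lemma comp_mult_swap:
  assumes g: "completely_multiplicative g" "g Q = - g P" and G: "G \<in> monic_polys"
  shows "g (swap G) = (-1) ^ (valuation P G + valuation Q G) * g G"
proof -
  obtain a b H where H: "G = P ^ a * Q ^ b * H" "\<not> P dvd H" "\<not> Q dvd H" "H \<in> monic_polys"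
    using G by (rule pair_decomp)
  have mult: "g (A * B) = g A * g B" if "A \<in> monic_polys" "B \<in> monic_polys" for A B
    using g(1) that by (simp add: completely_multiplicative_def)
  have power: "g (A ^ n * B) = g A ^ n * g B" if "A \<in> monic_polys" "B \<in> monic_polys" for A B n
    using that by (induction n) (simp_all add: mult monic_mult monic_power mult.assoc)
  \<comment> \<open>As \<open>g Q\<close> is \<open>- g P\<close>, the value depends on the two
    exponents only through their sum, which the exchange preserves, and the parity of the exponent
    of \<open>Q\<close>.\<close>
  have eq: "g (P ^ i * Q ^ j * H) = (-1) ^ j * g P ^ (i + j) * g H" for i j
    using H(4) monic by (simp add: power monic_mult monic_power mult.assoc g(2) power_add power_minus[of "g P"])
  have "g (swap G) = (-1) ^ a * g P ^ (b + a) * g H"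
    by (simp only: H(1) swap_eq[OF H(2,3)] eq)
  also have "\<dots> = (-1) ^ a * g P ^ (b + a) * g H * ((-1) ^ b * (-1) ^ b)"
    by (cases "even b") simp_all
  also have "\<dots> = (-1) ^ (a + b) * ((-1) ^ b * g P ^ (a + b) * g H)"
    by (simp only: power_add mult_ac)
  also have "\<dots> = (-1) ^ (valuation P G + valuation Q G) * g G"
    by (simp only: H(1) eq valuation_pair[OF H(2,3)])
  finally show ?thesis .
qed

text \<open>By \<open>comp_mult_swap\<close> the left-hand side is the right-hand side reindexed by
  the involution \<open>swap\<close>.\<close>

lemma sum_flip_signs:
  assumes "completely_multiplicative g" "g Q = - g P"
  shows "(\<Sum>G | G \<in> monic_polys \<and> degree G \<le> N. (-1) ^ (valuation P G + valuation Q G) * g G) =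
         (\<Sum>G | G \<in> monic_polys \<and> degree G \<le> N. g G)"
  by (rule sum.reindex_bij_witness[of _ swap swap]) (auto simp: swap_monic comp_mult_swap[OF assms])

end

section \<open>Exchanging infinitely many pairs\<close>

text \<open>There is one pair for each degree in \<open>S\<close>. Pairs of different degrees have
  no member in common, so they can be exchanged independently.\<close>

locale irreducible_pairs =
  fixes g :: "'a::{field,finite} poly \<Rightarrow> int" and S :: "nat set" and P Q :: "nat \<Rightarrow> 'a poly"
  assumes g: "completely_multiplicative g"
    and pair: "d \<in> S \<Longrightarrow> irreducible_pair (P d) (Q d)"
    and degree_P: "d \<in> S \<Longrightarrow> degree (P d) = d"
    and opposite: "d \<in> S \<Longrightarrow> g (Q d) = - g (P d)"
begin

text \<open>For \<open>d\<close> in \<open>S\<close> this is the completely multiplicative function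
  that is -1 at \<open>P d\<close> and \<open>Q d\<close> and 1 at all other monic irreducible
  polynomials.\<close>

definition sgn_at :: "nat \<Rightarrow> 'a poly \<Rightarrow> int" where
  "sgn_at d G = (-1) ^ (valuation (P d) G + valuation (Q d) G)"

text \<open>The set \<open>A\<close> may be infinite, so the product is cut off at the degree of
  \<open>G\<close>; by \<open>sgn_at_large\<close> the omitted factors are 1 when \<open>A\<close>
  lies in \<open>S\<close> and \<open>G\<close> is nonzero.\<close>

definition flip :: "nat set \<Rightarrow> 'a poly \<Rightarrow> int" where
  "flip A G = (\<Prod>d\<in>A \<inter> {..degree G}. sgn_at d G) * g G"

lemma degree_Q: "d \<in> S \<Longrightarrow> degree (Q d) = d"
  using pair degree_P irreducible_pair.deg by metis

lemma sgn_at_mult: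
  assumes "d \<in> S" "G \<noteq> 0" "G' \<noteq> 0"
  shows "sgn_at d (G * G') = sgn_at d G * sgn_at d G'"
  using irreducible_pair.irred[OF pair[OF assms(1)]] assms(2,3)
  by (simp add: sgn_at_def valuation_mult power_add mult_ac)

lemma sgn_at_large:
  assumes "d \<in> S" "G \<noteq> 0" "degree G < d"
  shows "sgn_at d G = 1"
  using assms by (simp add: sgn_at_def valuation_degree_less degree_P degree_Q)

text \<open>This allows one common cutoff for several polynomials of different degrees.\<close>

lemma flip_eq:
  assumes "A \<subseteq> S" "G \<noteq> 0" "degree G \<le> N"
  shows "flip A G = (\<Prod>d\<in>A \<inter> {..N}. sgn_at d G) * g G"
proof -
  have "(\<Prod>d\<in>A \<inter> {..degree G}. sgn_at d G) = (\<Prod>d\<in>A \<inter> {..N}. sgn_at d G)"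
    using assms by (intro prod.mono_neutral_left) (auto intro!: sgn_at_large)
  then show ?thesis
    by (simp add: flip_def)
qed

lemma completely_multiplicative_prod_sgn_at:
  assumes "B \<subseteq> S"
  shows "completely_multiplicative (\<lambda>G. (\<Prod>d\<in>B. sgn_at d G) * g G)"
  unfolding completely_multiplicative_def
proof (intro ballI)
  fix G G' :: "'a poly" assume G: "G \<in> monic_polys" "G' \<in> monic_polys"
  have "(\<Prod>d\<in>B. sgn_at d (G * G')) = (\<Prod>d\<in>B. sgn_at d G * sgn_at d G')"
    using assms G by (intro prod.cong refl sgn_at_mult) (auto simp: monic_nonzero)
  then show "(\<Prod>d\<in>B. sgn_at d (G * G')) * g (G * G') =
      (\<Prod>d\<in>B. sgn_at d G) * g G * ((\<Prod>d\<in>B. sgn_at d G') * g G')"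
    using g G by (simp add: prod.distrib completely_multiplicative_def mult_ac)
qed

lemma completely_multiplicative_flip:
  assumes "A \<subseteq> S"
  shows "completely_multiplicative (flip A)"
  unfolding completely_multiplicative_def
proof (intro ballI)
  fix G G' :: "'a poly" assume G: "G \<in> monic_polys" "G' \<in> monic_polys"
  define N where "N = degree (G * G')"
  have "degree (G * G') = degree G + degree G'"
    using G by (intro degree_mult_eq) (auto simp: monic_nonzero)
  then have "flip A F = (\<Prod>d\<in>A \<inter> {..N}. sgn_at d F) * g F" if "F \<in> {G, G', G * G'}" for F
    using that G by (intro flip_eq assms) (auto simp: N_def dest: monic_nonzero)
  moreover have "completely_multiplicative (\<lambda>G. (\<Prod>d\<in>A \<inter> {..N}. sgn_at d G) * g G)"
    using assms by (intro completely_multiplicative_prod_sgn_at) blast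
  ultimately show "flip A (G * G') = flip A G * flip A G'"
    using G by (simp add: completely_multiplicative_def)
qed

lemma sgn_at_PQ:
  assumes "d \<in> S" "e \<in> S"
  shows "sgn_at e (P d) = (if e = d then -1 else 1)" "sgn_at e (Q d) = (if e = d then -1 else 1)"
proof -
  interpret d: irreducible_pair "P d" "Q d"
    using assms(1) by (rule pair)
  interpret e: irreducible_pair "P e" "Q e"
    using assms(2) by (rule pair)
  have dvd: "F dvd F' \<Longrightarrow> F = F'" if "F \<in> {P d, Q d, P e, Q e}" "F' \<in> {P d, Q d, P e, Q e}" for F F'
    using that d.monic d.irred e.monic e.irred by (auto dest: monic_irreducible_dvd_imp_eq)
  have self: "valuation F F = 1" if "irreducible F" for F :: "'a poly"
    using that valuation_eqI[of F 1 1] by (simp add: irreducible_def)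
  have "sgn_at d (P d) = -1" "sgn_at d (Q d) = -1"
    using d.not_dvd d.irred d.nonzero by (auto simp: sgn_at_def self valuation_eq_0)
  moreover have "sgn_at e (P d) = 1 \<and> sgn_at e (Q d) = 1" if "e \<noteq> d"
  proof -
    have "\<not> F dvd F'" if "F \<in> {P e, Q e}" "F' \<in> {P d, Q d}" for F F'
    proof -
      have "degree F = e" "degree F' = d"
        using that degree_P[OF assms(1)] degree_Q[OF assms(1)] degree_P[OF assms(2)] degree_Q[OF assms(2)]
        by auto
      with \<open>e \<noteq> d\<close> have "F \<noteq> F'"
        by blast
      moreover have "F \<in> {P d, Q d, P e, Q e}" "F' \<in> {P d, Q d, P e, Q e}"
        using that by auto
      ultimately show ?thesis
        using dvd by metis
    qed
    then show ?thesis
      using e.nonzero by (auto simp: sgn_at_def valuation_eq_0)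
  qed
  ultimately show "sgn_at e (P d) = (if e = d then -1 else 1)" "sgn_at e (Q d) = (if e = d then -1 else 1)"
    by auto
qed

text \<open>If \<open>g (P d)\<close> is nonzero, the value at \<open>P d\<close> reveals whether
  \<open>d\<close> belongs to \<open>A\<close>; this yields injectivity in \<open>A\<close>.\<close>

lemma flip_P:
  assumes "A \<subseteq> S" "d \<in> S"
  shows "flip A (P d) = (if d \<in> A then - g (P d) else g (P d))"
proof -
  have "(\<Prod>e\<in>A \<inter> {..d}. sgn_at e (P d)) = (\<Prod>e\<in>A \<inter> {..d}. if e = d then -1 else 1)"
    using assms by (intro prod.cong refl sgn_at_PQ) auto
  also have "\<dots> = (if d \<in> A then -1 else 1)"
    by (subst prod.delta) auto
  finally show ?thesis
    using assms by (simp add: flip_def degree_P)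
qed

text \<open>Up to degree \<open>N\<close> only finitely many pairs matter, and these are exchanged
  one at a time.\<close>

lemma sum_flip:
  assumes "A \<subseteq> S"
  shows "(\<Sum>G | G \<in> monic_polys \<and> degree G \<le> N. flip A G) = (\<Sum>G | G \<in> monic_polys \<and> degree G \<le> N. g G)"
proof -
  have finite_case: "(\<Sum>G | G \<in> monic_polys \<and> degree G \<le> N. (\<Prod>d\<in>B. sgn_at d G) * g G) =
        (\<Sum>G | G \<in> monic_polys \<and> degree G \<le> N. g G)" if "finite B" "B \<subseteq> S" for B
    using that
  proof (induction B)
    case (insert d B)
    then have d: "d \<in> S" "B \<subseteq> S"
      by auto
    interpret irreducible_pair "P d" "Q d"
      using d(1) by (rule pair)
    let ?h = "\<lambda>G. (\<Prod>d\<in>B. sgn_at d G) * g G"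
    \<comment> \<open>The earlier sign changes do not affect the values at the new pair, which
      therefore remain opposite, as \<open>sum_flip_signs\<close> requires.\<close>
    have "(\<Prod>e\<in>B. sgn_at e (P d)) = 1" "(\<Prod>e\<in>B. sgn_at e (Q d)) = 1"
      using insert.hyps(2) d by (auto intro!: prod.neutral simp: sgn_at_PQ subsetD)
    then have "?h (Q d) = - ?h (P d)"
      using opposite d(1) by simp
    then have "(\<Sum>G | G \<in> monic_polys \<and> degree G \<le> N. (-1) ^ (valuation (P d) G + valuation (Q d) G) * ?h G) =
        (\<Sum>G | G \<in> monic_polys \<and> degree G \<le> N. ?h G)"
      by (intro sum_flip_signs completely_multiplicative_prod_sgn_at d(2))
    then show ?case
      using insert.hyps insert.IH d(2) by (simp add: sgn_at_def[of d] mult.assoc)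
  qed simp
  have "(\<Sum>G | G \<in> monic_polys \<and> degree G \<le> N. (\<Prod>d\<in>A \<inter> {..N}. sgn_at d G) * g G) =
        (\<Sum>G | G \<in> monic_polys \<and> degree G \<le> N. g G)"
    by (rule finite_case) (use assms in auto)
  moreover have "(\<Sum>G | G \<in> monic_polys \<and> degree G \<le> N. flip A G) =
      (\<Sum>G | G \<in> monic_polys \<and> degree G \<le> N. (\<Prod>d\<in>A \<inter> {..N}. sgn_at d G) * g G)"
    using assms by (intro sum.cong refl flip_eq) (auto simp: monic_nonzero)
  ultimately show ?thesis
    by simp
qed

end

section \<open>From bounded partial sums to uncountably many functions\<close>

lemma long_sum_discrepancy_finite:
  assumes f: "completely_multiplicative f" "\<And>G. G \<in> monic_polys \<Longrightarrow> f G \<in> {-1, 1}"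
    and bound: "\<And>N. \<bar>\<Sum>G | G \<in> monic_polys \<and> degree G \<le> N. f G\<bar> \<le> B"
  shows "long_sum_discrepancy f < \<infinity>"
proof -
  have "\<bar>\<Sum>G | G \<in> monic_polys \<and> degree G \<le> N. f (D * G)\<bar> \<le> B" if "D \<in> monic_polys" for D N
  proof -
    \<comment> \<open>The shift by \<open>D\<close> only contributes a factor of absolute value 1,
      so the bound is uniform in \<open>D\<close>.\<close>
    have "(\<Sum>G | G \<in> monic_polys \<and> degree G \<le> N. f (D * G)) =
        f D * (\<Sum>G | G \<in> monic_polys \<and> degree G \<le> N. f G)"
      using f(1) that by (simp add: completely_multiplicative_def sum_distrib_left)
    moreover have "\<bar>f D\<bar> = 1"
      using f(2)[OF that] by auto
    ultimately show ?thesis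
      using bound by (simp add: abs_mult)
  qed
  then have "long_sum_discrepancy f \<le> ereal (real_of_int B)"
    unfolding long_sum_discrepancy_def by (intro SUP_least) (auto simp del: of_int_abs)
  then show ?thesis
    by (rule le_less_trans) simp
qed

text \<open>An infinite \<open>A\<close> contains a copy of the natural numbers, so a countable
  power set would embed into \<open>A\<close>, contrary to Cantor's theorem.\<close>

lemma uncountable_Pow_infinite:
  assumes "infinite A"
  shows "uncountable (Pow A)"
proof
  assume "countable (Pow A)"
  then have "Pow A \<lesssim> (UNIV :: nat set)"
    by (auto simp: countable_def lepoll_def)
  also have "(UNIV :: nat set) \<lesssim> A"
    using assms by (simp add: infinite_le_lepoll)
  finally show False
    using lesspoll_Pow_self[of A] lepoll_antisym unfolding lesspoll_def by blast
qed

theorem proposition1p1: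
  fixes q :: nat
  assumes "card (UNIV :: 'a::{field,finite} set) = q"
  shows "uncountable {f \<in> (monic_polys :: 'a poly set) \<rightarrow>\<^sub>E {-1, 1 :: int}.
           completely_multiplicative f \<and> long_sum_discrepancy f < \<infinity>}"
proof
  let ?F = "{f \<in> (monic_polys :: 'a poly set) \<rightarrow>\<^sub>E {-1, 1 :: int}.
    completely_multiplicative f \<and> long_sum_discrepancy f < \<infinity>}"
  assume countable: "countable ?F"
  obtain \<chi> :: "'a \<Rightarrow> 'a \<Rightarrow> int" where "unit_character \<chi>"
    using unit_character_exists by blast
  then interpret unit_character \<chi> .
  obtain B where B: "\<And>N. \<bar>partial_sum N\<bar> \<le> B"
    using partial_sum_bounded by blast
  define good where "good d P \<longleftrightarrow>
    P \<in> monic_polys \<and> irreducible P \<and> degree P = d \<and> ext P \<noteq> ext (pcompose P [:1, 1:])" for d P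
  define S where "S = {d. \<exists>P. good d P}"
  have "\<exists>d\<ge>D. d \<in> S" for D
    using exists_irreducible_shift_neq[of D] by (auto simp: S_def good_def)
  then have "infinite S"
    by (meson infinite_nat_iff_unbounded_le)
  define P where "P d = (SOME P. good d P)" for d
  define Q where "Q d = pcompose (P d) [:1, 1:]" for d
  have P: "good d (P d)" if "d \<in> S" for d
    using that unfolding P_def S_def by (auto intro: someI)
  interpret irreducible_pairs ext S P Q
  proof (rule irreducible_pairs.intro)
    fix d assume "d \<in> S"
    then have d: "good d (P d)"
      by (rule P)
    show "irreducible_pair (P d) (Q d)"
      using d by unfold_locales
        (auto simp: good_def Q_def monic_shift irreducible_shift degree_pcompose)
    show "degree (P d) = d"
      using d by (simp add: good_def)
    show "ext (Q d) = - ext (P d)"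
      using d ext_sign[of "P d"] ext_sign[of "Q d"] by (auto simp: good_def Q_def)
  qed (rule completely_multiplicative_ext)
  have sgn_at_sign: "(\<Prod>d\<in>A. sgn_at d G) \<in> {-1, 1}" for A G
    by (induction A rule: infinite_finite_induct) (auto simp: sgn_at_def minus_one_power_iff)
  have flip_sign: "flip A G \<in> {-1, 1}" for A G
    using ext_sign[of G] sgn_at_sign[of G "A \<inter> {..degree G}"] by (auto simp: flip_def)
  \<comment> \<open>Restriction fixes the values off the monic polynomials, so that only genuinely
    different functions on them are counted.\<close>
  have in_F: "restrict (flip A) monic_polys \<in> ?F" if "A \<subseteq> S" for A
  proof -
    let ?f = "restrict (flip A) monic_polys"
    have "?f \<in> monic_polys \<rightarrow>\<^sub>E {-1, 1}"
      using flip_sign by auto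
    moreover have mult: "completely_multiplicative ?f"
      using completely_multiplicative_flip[OF that]
      by (simp add: completely_multiplicative_def monic_mult)
    moreover have "long_sum_discrepancy ?f < \<infinity>"
    proof (rule long_sum_discrepancy_finite[OF mult])
      fix N
      show "\<bar>\<Sum>G | G \<in> monic_polys \<and> degree G \<le> N. ?f G\<bar> \<le> B"
        using B[of N] sum_flip[OF that, of N] by (simp add: partial_sum_def)
    qed (use flip_sign in simp)
    ultimately show ?thesis
      by blast
  qed
  \<comment> \<open>Each \<open>P d\<close> is monic, so the values that determine \<open>A\<close>
    survive the restriction.\<close>
  have "inj_on (\<lambda>A. restrict (flip A) monic_polys) (Pow S)"
  proof (rule inj_onI)
    fix A A' assume A: "A \<in> Pow S" "A' \<in> Pow S"
      and eq: "restrict (flip A) monic_polys = restrict (flip A') monic_polys"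
    have "d \<in> A \<longleftrightarrow> d \<in> A'" if "d \<in> S" for d
    proof -
      have "P d \<in> monic_polys"
        using P[OF that] by (simp add: good_def)
      then have "flip A (P d) = flip A' (P d)"
        using fun_cong[OF eq, of "P d"] by simp
      moreover have "ext (P d) \<noteq> 0"
        using ext_sign[of "P d"] by auto
      ultimately show ?thesis
        using A that by (auto simp: flip_P split: if_splits)
    qed
    with A show "A = A'"
      by blast
  qed
  moreover have "countable ((\<lambda>A. restrict (flip A) monic_polys) ` Pow S)"
    using in_F by (intro countable_subset[OF _ countable] image_subsetI) simp
  ultimately have "countable (Pow S)"
    by (rule countable_image_inj_on[rotated])
  with uncountable_Pow_infinite[OF \<open>infinite S\<close>] show False
    by simp
qed

end
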